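(* Let $R$ be a commutative ring with unity. The strong metric dimension of $\mathrm{Cl}(R)$ is finite if and only if $\mathrm{Cl}(R)$ is a finite graph; likewise, the strong metric dimension of $\mathrm{Cl}_2(R)$ is finite if and only if $\mathrm{Cl}_2(R)$ is a finite graph.
   Context: $U(R)$ is the set of units, $\mathrm{Id}(R)$ the set of idempotents. The clean graph $\mathrm{Cl}(R)$ has vertex set $\{(e,u): e\in\mathrm{Id}(R), u\in U(R)\}$, two distinct vertices $(e,u),(f,v)$ being adjacent iff $ef=0$ or $uv=1$; $\mathrm{Cl}_2(R)$ is its subgraph induced by the vertices with $e\neq 0$. A graph is finite if its vertex set is finite. In a graph, a vertex $w$ strongly resolves vertices $x,y$ if some shortest $x$–$w$ path contains $y$ or some shortest $y$–$w$ path contains $x$; a strong resolving set is a set $S$ of vertices such that every two distinct vertices are strongly resolved by some vertex of $S$; the strong metric dimension $\mathrm{sdim}$ is the smallest cardinality of a strong resolving set.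
   Formalization: For a disconnected Cl_2(R) (e.g. R = F_3) no strong resolving set exists literally, so sdim is undefined; here two vertices not joined by a path count as resolved by S when one of them lies in S. Nothing changes for connected graphs. *)

theory Defs
  imports
    "HOL-Algebra.Ring"
    "HOL-Library.Extended_Nat"
    "Graph_Theory.Digraph_Component"
    "Graph_Theory.Vertex_Walk"
begin

definition idempotents :: "('r, 'm) ring_scheme \<Rightarrow> 'r set" where
  "idempotents R = {e \<in> carrier R. e \<otimes>\<^bsub>R\<^esub> e = e}"

text \<open>A simple graph is represented by the loop-free symmetric digraph having both
  orientations of every edge.\<close>

definition clean_graph :: "('r, 'm) ring_scheme \<Rightarrow> ('r \<times> 'r, ('r \<times> 'r) \<times> ('r \<times> 'r)) pre_digraph" where
  "clean_graph R = with_proj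
     \<lparr> pverts = idempotents R \<times> Units R,
       parcs = {((e, u), (f, v)) | e u f v.
         (e, u) \<in> idempotents R \<times> Units R \<and> (f, v) \<in> idempotents R \<times> Units R \<and>
         (e, u) \<noteq> (f, v) \<and> (e \<otimes>\<^bsub>R\<^esub> f = \<zero>\<^bsub>R\<^esub> \<or> u \<otimes>\<^bsub>R\<^esub> v = \<one>\<^bsub>R\<^esub>)} \<rparr>"

definition clean_graph2 :: "('r, 'm) ring_scheme \<Rightarrow> ('r \<times> 'r, ('r \<times> 'r) \<times> ('r \<times> 'r)) pre_digraph" where
  "clean_graph2 R = clean_graph R \<restriction> {(e, u) \<in> verts (clean_graph R). e \<noteq> \<zero>\<^bsub>R\<^esub>}"

definition path_between :: "('a, 'b) pre_digraph \<Rightarrow> 'a \<Rightarrow> 'a list \<Rightarrow> 'a \<Rightarrow> bool" where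
  "path_between G x p y \<longleftrightarrow> vpath p G \<and> hd p = x \<and> last p = y"

definition shortest_path :: "('a, 'b) pre_digraph \<Rightarrow> 'a \<Rightarrow> 'a list \<Rightarrow> 'a \<Rightarrow> bool" where
  "shortest_path G x p y \<longleftrightarrow> path_between G x p y \<and>
     (\<forall>q. path_between G x q y \<longrightarrow> vwalk_length p \<le> vwalk_length q)"

definition strongly_resolves :: "('a, 'b) pre_digraph \<Rightarrow> 'a \<Rightarrow> 'a \<Rightarrow> 'a \<Rightarrow> bool" where
  "strongly_resolves G w x y \<longleftrightarrow>
     (\<exists>p. shortest_path G x p w \<and> y \<in> set p) \<or> (\<exists>p. shortest_path G y p w \<and> x \<in> set p)"

text \<open>Strong resolving sets are usually considered for connected graphs only; there every pair
  of vertices falls under the first alternative below, which is the usual condition. But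
  the induced subgraph \<^term>\<open>clean_graph2 R\<close> is disconnected when \<open>R\<close> has
  only the trivial idempotents and more than one unit. Two vertices in different components are
  strongly resolved by no vertex at all (see \<open>not_strongly_resolves_disconnected\<close>), so that
  a disconnected graph, even a finite one, would have no strong resolving set and its strong
  metric dimension would be undefined. In a connected graph the vertices \<open>x\<close> and \<open>y\<close>
  themselves always strongly resolve the pair \<open>x\<close>, \<open>y\<close>; we keep exactly this for
  pairs that are not joined by a path. Thus the set of all vertices is strong resolving in
  every graph.\<close>

definition strong_resolving_set :: "('a, 'b) pre_digraph \<Rightarrow> 'a set \<Rightarrow> bool" where
  "strong_resolving_set G S \<longleftrightarrow> S \<subseteq> verts G \<and>
     (\<forall>x \<in> verts G. \<forall>y \<in> verts G. x \<noteq> y \<longrightarrow>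
        (if \<exists>p. path_between G x p y then \<exists>w \<in> S. strongly_resolves G w x y
         else x \<in> S \<or> y \<in> S))"

text \<open>All infinite cardinalities are identified with \<^term>\<open>\<infinity>\<close>.\<close>

definition sdim :: "('a, 'b) pre_digraph \<Rightarrow> enat" where
  "sdim G = Inf {if finite S then enat (card S) else \<infinity> | S. strong_resolving_set G S}"

lemma strong_resolving_set_connected:
  assumes "\<And>x y. x \<in> verts G \<Longrightarrow> y \<in> verts G \<Longrightarrow> \<exists>p. path_between G x p y"
  shows "strong_resolving_set G S \<longleftrightarrow> S \<subseteq> verts G \<and>
    (\<forall>x \<in> verts G. \<forall>y \<in> verts G. x \<noteq> y \<longrightarrow> (\<exists>w \<in> S. strongly_resolves G w x y))"
  using assms by (simp add: strong_resolving_set_def)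

lemma path_between_prefix:
  assumes "path_between G x p w" "y \<in> set p"
  shows "\<exists>q. path_between G x q y"
proof -
  obtain p1 p2 where p: "p = p1 @ y # p2"
    using assms(2) by (meson split_list)
  have "set (vwalk_arcs (p1 @ [y])) \<subseteq> set (vwalk_arcs p)"
    using set_vwalk_arcs_append1[of "p1 @ [y]" p2] by (simp add: p)
  moreover have "hd (p1 @ [y]) = hd p"
    by (simp add: p hd_append)
  ultimately have "path_between G x (p1 @ [y]) y"
    using assms(1) unfolding path_between_def vpath_def vwalk_def by (auto simp: p)
  then show ?thesis ..
qed

lemma not_strongly_resolves_disconnected:
  assumes "\<nexists>p. path_between G x p y" "\<nexists>p. path_between G y p x"
  shows "\<not> strongly_resolves G w x y"
  using assms path_between_prefix unfolding strongly_resolves_def shortest_path_def by metis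

lemma strong_resolving_set_verts:
  "strong_resolving_set G (verts G)"
proof -
  have "\<exists>w \<in> verts G. strongly_resolves G w x y"
    if y: "y \<in> verts G" and ex: "\<exists>p. path_between G x p y" for x y
  proof -
    obtain p where p: "path_between G x p y"
      "\<And>q. path_between G x q y \<Longrightarrow> vwalk_length p \<le> vwalk_length q"
      using ex ex_has_least_nat[of "\<lambda>p. path_between G x p y" _ vwalk_length] by blast
    have "y \<in> set p"
      using p(1) unfolding path_between_def vpath_def vwalk_def by auto
    with p have "strongly_resolves G y x y"
      unfolding strongly_resolves_def shortest_path_def by blast
    with y show ?thesis by blast
  qed
  then show ?thesis
    unfolding strong_resolving_set_def by auto
qed

lemma clean_graph_adjacent_iff:
  "(e, u) \<rightarrow>\<^bsub>clean_graph R\<^esub> (f, v) \<longleftrightarrow>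
     (e, u) \<in> verts (clean_graph R) \<and> (f, v) \<in> verts (clean_graph R) \<and> (e, u) \<noteq> (f, v) \<and>
     (e \<otimes>\<^bsub>R\<^esub> f = \<zero>\<^bsub>R\<^esub> \<or> u \<otimes>\<^bsub>R\<^esub> v = \<one>\<^bsub>R\<^esub>)"
  by (auto simp: clean_graph_def)

end

theory Submission
  imports Defs
begin

text \<open>Let \<open>S\<close> be a finite strong resolving set of a graph in which joined vertices are at distance
  at most \<open>D\<close>. If \<open>w \<in> S\<close> strongly resolves \<open>x\<close> and \<open>y\<close>, then \<open>w\<close> has different distances to
  \<open>x\<close> and \<open>y\<close>, so a vertex outside \<open>S\<close> is determined by its distances to the members of \<open>S\<close>; there
  are only finitely many such vectors, and the graph is finite. In the clean graph every
  vertex is joined to \<open>(0, 1)\<close>, so \<open>D = 2\<close>. In the subgraph, if \<open>g\<close> is an idempotent other than 0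
  and 1, then \<open>(e, u), (g, u\<^sup>-\<^sup>1), (1 - g, 1), (g, v\<^sup>-\<^sup>1), (f, v)\<close> is a walk (up to
  repetitions), so \<open>D = 4\<close>; if there is no
  such \<open>g\<close>, the edges form a matching, so \<open>D = 1\<close>.\<close>

section \<open>Paths and distances in a digraph\<close>

lemma path_between_suffix:
  assumes "path_between G x (p @ y # q) z"
  shows "path_between G y (y # q) z"
  using assms vwalkI_append_r[of "y # q" p G]
  unfolding path_between_def vpath_def by auto

lemma path_between_refl:
  assumes "x \<in> verts G"
  shows "path_between G x [x] x"
  using assms unfolding path_between_def by (auto simp: vpath_def vwalk_def)

definition within_distance :: "('a, 'b) pre_digraph \<Rightarrow> nat \<Rightarrow> 'a \<Rightarrow> 'a \<Rightarrow> bool" where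
  "within_distance G n x y \<longleftrightarrow> (\<exists>p. path_between G x p y \<and> vwalk_length p \<le> n)"

lemma within_distance_refl: "x \<in> verts G \<Longrightarrow> within_distance G 0 x x"
  using path_between_refl unfolding within_distance_def by fastforce

text \<open>Prepending \<open>x\<close> may repeat a vertex, which \<open>vpath\<close> forbids;
  then the part of the path from \<open>x\<close> on serves, and it is no longer than before.
  Allowing \<open>x = y\<close> lets the steps of a walk degenerate.\<close>

lemma within_distance_step:
  assumes "x \<in> verts G" "x = y \<or> x \<rightarrow>\<^bsub>G\<^esub> y" "within_distance G n y z"
  shows "within_distance G (Suc n) x z"
proof -
  obtain p where p: "path_between G y p z" "length p - 1 \<le> n"
    using assms(3) unfolding within_distance_def by auto
  show ?thesis
  proof (cases "x \<in> set p")
    case True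
    then obtain p1 p2 where "p = p1 @ x # p2"
      by (meson split_list)
    with p path_between_suffix[of G y p1 x p2 z] show ?thesis
      unfolding within_distance_def by (intro exI[of _ "x # p2"]) auto
  next
    case False
    have "p \<noteq> []" and "hd p = y" and "vwalk p G"
      using p(1) unfolding path_between_def vpath_def vwalk_def by auto
    \<comment> \<open>If \<open>x = y\<close>, then \<open>x\<close> would be the head of
      \<open>p\<close>.\<close>
    moreover from this False have "x \<rightarrow>\<^bsub>G\<^esub> y"
      using assms(2) hd_in_set by metis
    ultimately have "path_between G x (x # p) z"
      using p(1) False assms(1) vwalk_consI[of p G x]
      unfolding path_between_def vpath_def by auto
    then show ?thesis
      using p(2) unfolding within_distance_def by (intro exI[of _ "x # p"]) auto
  qed
qed

text \<open>For vertices that are not joined by a path this is the unspecified number \<open>Inf {}\<close>.\<close>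

definition distance :: "('a, 'b) pre_digraph \<Rightarrow> 'a \<Rightarrow> 'a \<Rightarrow> nat" where
  "distance G x y = Inf {vwalk_length p | p. path_between G x p y}"

lemma distance_le:
  assumes "path_between G x p y"
  shows "distance G x y \<le> vwalk_length p"
  unfolding distance_def using assms by (intro wellorder_Inf_le1) blast

lemma distance_shortest_path:
  assumes "shortest_path G x p y"
  shows "distance G x y = vwalk_length p"
  unfolding distance_def
  using assms by (intro cInf_eq_minimum) (auto simp: shortest_path_def)

text \<open>The part of \<open>p\<close> from \<open>y\<close> on leads to \<open>w\<close>, and it
  is strictly shorter than \<open>p\<close> because \<open>p\<close> starts at
  \<open>x \<noteq> y\<close>.\<close>

lemma distance_less_on_shortest_path:
  assumes "shortest_path G x p w" "y \<in> set p" "x \<noteq> y"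
  shows "distance G y w < distance G x w"
proof -
  obtain p1 p2 where p: "p = p1 @ y # p2"
    using assms(2) by (meson split_list)
  have path: "path_between G x p w"
    using assms(1) unfolding shortest_path_def by blast
  have "p1 \<noteq> []"
    using path assms(3) unfolding p path_between_def by auto
  have "distance G y w \<le> vwalk_length (y # p2)"
    using path distance_le path_between_suffix unfolding p by metis
  also have "\<dots> < vwalk_length p"
    using \<open>p1 \<noteq> []\<close> unfolding p by simp
  also have "\<dots> = distance G x w"
    using assms(1) by (simp only: distance_shortest_path)
  finally show ?thesis .
qed

section \<open>From strong resolving sets to finiteness\<close>

lemma strongly_resolves_distance_neq:
  assumes "strongly_resolves G w x y" "x \<noteq> y"
  shows "distance G x w \<noteq> distance G y w"
  using assms distance_less_on_shortest_path
  unfolding strongly_resolves_def by (metis nat_neq_iff)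

lemma finite_verts_if_finite_strong_resolving_set:
  assumes S: "strong_resolving_set G S" "finite S"
    and D: "\<And>x p y. path_between G x p y \<Longrightarrow> within_distance G D x y"
  shows "finite (verts G)"
proof -
  define code where "code x = (\<lambda>w\<in>S. distance G x w)" for x
  \<comment> \<open>A member \<open>w\<close> of \<open>S\<close> need not be reachable from
    \<open>x\<close>; all such cases share the one default value \<open>Inf {}\<close>.\<close>
  have "distance G x w \<in> insert (Inf {}) {..D}" for x w
  proof (cases "\<exists>p. path_between G x p w")
    case True
    then show ?thesis
      using D distance_le unfolding within_distance_def by (meson atMost_iff insertCI le_trans)
  next
    case False
    then show ?thesis
      unfolding distance_def by simp
  qed
  then have "code ` (verts G - S) \<subseteq> S \<rightarrow>\<^sub>E insert (Inf {}) {..D}"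
    unfolding code_def by (meson image_subsetI restrict_PiE_iff)
  then have "finite (code ` (verts G - S))"
    using S(2) by (meson finite.insertI finite_PiE finite_atMost finite_subset)
  moreover have "inj_on code (verts G - S)"
  proof (rule inj_onI, rule ccontr)
    fix x y assume xy: "x \<in> verts G - S" "y \<in> verts G - S" "code x = code y" "x \<noteq> y"
    \<comment> \<open>If \<open>x\<close> and \<open>y\<close> were not joined, one of them would
      lie in \<open>S\<close>.\<close>
    then obtain w where "w \<in> S" "strongly_resolves G w x y"
      using S(1) unfolding strong_resolving_set_def by (metis Diff_iff)
    with xy show False
      using strongly_resolves_distance_neq unfolding code_def by (metis restrict_apply')
  qed
  ultimately have "finite (verts G - S)"
    using finite_imageD by blast
  then show ?thesis
    using S(2) by simp
qed

text \<open>In a linear order an infimum lies below \<infinity> iff some member does, and infinite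
  sets contribute only \<infinity>.\<close>

lemma sdim_finite_iff:
  "sdim G < \<infinity> \<longleftrightarrow> (\<exists>S. finite S \<and> strong_resolving_set G S)"
  unfolding sdim_def Inf_less_iff by auto

text \<open>For the converse direction, the set of all vertices is strong resolving. Bounding only
  joined pairs admits disconnected graphs.\<close>

lemma sdim_finite_iff_finite_verts:
  assumes "\<And>x p y. path_between G x p y \<Longrightarrow> within_distance G D x y"
  shows "sdim G < \<infinity> \<longleftrightarrow> finite (verts G)"
proof
  assume "sdim G < \<infinity>"
  then obtain S where "strong_resolving_set G S" "finite S"
    unfolding sdim_finite_iff by blast
  then show "finite (verts G)"
    using finite_verts_if_finite_strong_resolving_set assms by blast
next
  assume "finite (verts G)"
  then show "sdim G < \<infinity>"
    unfolding sdim_finite_iff using strong_resolving_set_verts by blast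
qed

section \<open>Length bounds in the two clean graphs\<close>

lemma path_between_verts:
  assumes "path_between G x p y"
  shows "x \<in> verts G" "y \<in> verts G"
  using assms unfolding path_between_def vpath_def vwalk_def
  by (metis hd_in_set last_in_set subsetD)+

lemma verts_clean_graph: "verts (clean_graph R) = idempotents R \<times> Units R"
  by (simp add: clean_graph_def)

lemma verts_clean_graph2:
  "verts (clean_graph2 R) = (idempotents R - {\<zero>\<^bsub>R\<^esub>}) \<times> Units R"
  by (auto simp: clean_graph2_def verts_clean_graph)

lemma clean_graph2_adjacent_iff:
  "(e, u) \<rightarrow>\<^bsub>clean_graph2 R\<^esub> (f, v) \<longleftrightarrow>
     (e, u) \<in> verts (clean_graph2 R) \<and> (f, v) \<in> verts (clean_graph2 R) \<and> (e, u) \<noteq> (f, v) \<and>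
     (e \<otimes>\<^bsub>R\<^esub> f = \<zero>\<^bsub>R\<^esub> \<or> u \<otimes>\<^bsub>R\<^esub> v = \<one>\<^bsub>R\<^esub>)"
  by (auto simp: clean_graph2_def clean_graph_def arcs_ends_conv)

context cring
begin

lemma within_distance_clean_graph:
  assumes "x \<in> verts (clean_graph R)" "y \<in> verts (clean_graph R)"
  shows "within_distance (clean_graph R) 2 x y"
proof -
  obtain e u f v where xy: "x = (e, u)" "y = (f, v)"
    by fastforce
  let ?c = "(\<zero>, \<one>)"
  have c: "?c \<in> verts (clean_graph R)"
    by (simp add: verts_clean_graph idempotents_def)
  have ef: "e \<in> carrier R" "f \<in> carrier R"
    using assms xy by (auto simp: verts_clean_graph idempotents_def)
  have "x = ?c \<or> x \<rightarrow>\<^bsub>clean_graph R\<^esub> ?c" "?c = y \<or> ?c \<rightarrow>\<^bsub>clean_graph R\<^esub> y"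
    using assms c ef unfolding xy clean_graph_adjacent_iff by auto
  then have "within_distance (clean_graph R) (Suc (Suc 0)) x y"
    using within_distance_step within_distance_refl assms c by metis
  then show ?thesis
    by (simp add: numeral_2_eq_2)
qed

lemma complement_idempotent:
  assumes "g \<in> idempotents R"
  shows "\<one> \<ominus> g \<in> idempotents R" "g \<otimes> (\<one> \<ominus> g) = \<zero>"
proof -
  have g: "g \<in> carrier R" "g \<otimes> g = g"
    using assms by (auto simp: idempotents_def)
  then show gg: "g \<otimes> (\<one> \<ominus> g) = \<zero>"
    by (simp add: minus_eq r_distr r_minus r_neg)
  \<comment> \<open>The subtracted product vanishes by \<open>gg\<close>.\<close>
  have "(\<one> \<ominus> g) \<otimes> (\<one> \<ominus> g) = (\<one> \<ominus> g) \<ominus> g \<otimes> (\<one> \<ominus> g)"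
    using g(1) by (simp add: minus_eq l_distr l_minus)
  then show "\<one> \<ominus> g \<in> idempotents R"
    using g gg by (simp add: idempotents_def minus_eq)
qed

lemma within_distance_clean_graph2:
  assumes g: "g \<in> idempotents R" "g \<noteq> \<zero>" "g \<noteq> \<one>"
    and xy: "x \<in> verts (clean_graph2 R)" "y \<in> verts (clean_graph2 R)"
  shows "within_distance (clean_graph2 R) 4 x y"
proof -
  obtain e u f v where x: "x = (e, u)" and y: "y = (f, v)"
    by fastforce
  have uv: "u \<in> Units R" "v \<in> Units R"
    using xy unfolding x y by (auto simp: verts_clean_graph2)
  let ?a = "(g, inv u)" and ?b = "(\<one> \<ominus> g, \<one>)" and ?c = "(g, inv v)"
  have gc: "g \<in> carrier R"
    using g(1) by (simp add: idempotents_def)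
  \<comment> \<open>This keeps \<open>?b\<close> in the subgraph, whose vertices have nonzero first
    component.\<close>
  have "\<one> \<ominus> g \<noteq> \<zero>"
    using g(3) gc minus_equality[of "\<one>" "\<ominus> g"] by (auto simp: minus_eq)
  then have verts: "?a \<in> verts (clean_graph2 R)" "?b \<in> verts (clean_graph2 R)"
      "?c \<in> verts (clean_graph2 R)"
    using g uv complement_idempotent by (auto simp: verts_clean_graph2)
  have orth: "g \<otimes> (\<one> \<ominus> g) = \<zero>" "(\<one> \<ominus> g) \<otimes> g = \<zero>"
    using complement_idempotent[OF g(1)] gc by (auto simp: m_comm)
  \<comment> \<open>The outer steps use inverse units, whatever \<open>e\<close> and
    \<open>f\<close> are; the inner ones use that \<open>g\<close> and
    \<open>\<one> \<ominus> g\<close> annihilate each other.\<close>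
  have steps: "x = ?a \<or> x \<rightarrow>\<^bsub>clean_graph2 R\<^esub> ?a" "?a = ?b \<or> ?a \<rightarrow>\<^bsub>clean_graph2 R\<^esub> ?b"
    "?b = ?c \<or> ?b \<rightarrow>\<^bsub>clean_graph2 R\<^esub> ?c" "?c = y \<or> ?c \<rightarrow>\<^bsub>clean_graph2 R\<^esub> y"
    using xy verts orth uv unfolding x y clean_graph2_adjacent_iff by auto
  have "within_distance (clean_graph2 R) (Suc (Suc (Suc (Suc 0)))) x y"
    by (rule within_distance_step[OF xy(1) steps(1)] within_distance_step[OF verts(1) steps(2)]
        within_distance_step[OF verts(2) steps(3)] within_distance_step[OF verts(3) steps(4)]
        within_distance_refl[OF xy(2)])+
  then show ?thesis
    by (simp add: eval_nat_numeral)
qed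

lemma path_length_clean_graph2_trivial_idempotents:
  assumes triv: "idempotents R \<subseteq> {\<zero>, \<one>}"
    and path: "path_between (clean_graph2 R) x p y"
  shows "vwalk_length p \<le> 1"
proof (rule ccontr)
  assume "\<not> vwalk_length p \<le> 1"
  then obtain a b c q where p: "p = a # b # c # q"
    by (cases p; cases "tl p"; cases "tl (tl p)") auto
  obtain e u f v g w where abc: "a = (e, u)" "b = (f, v)" "c = (g, w)"
    by (metis surj_pair)
  have verts: "a \<in> verts (clean_graph2 R)" "b \<in> verts (clean_graph2 R)"
      "c \<in> verts (clean_graph2 R)" and "a \<noteq> c"
    and arcs: "a \<rightarrow>\<^bsub>clean_graph2 R\<^esub> b" "b \<rightarrow>\<^bsub>clean_graph2 R\<^esub> c"
    using path unfolding p path_between_def vpath_def vwalk_def by auto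
  \<comment> \<open>A nonzero idempotent must be \<open>\<one>\<close>, and having one excludes the
    zero ring.\<close>
  have one: "e = \<one>" "f = \<one>" "g = \<one>" "\<one> \<noteq> \<zero>"
    and units: "u \<in> Units R" "v \<in> Units R" "w \<in> Units R"
    using verts triv unfolding abc by (auto simp: verts_clean_graph2)
  have "u \<otimes> v = \<one>" "v \<otimes> w = \<one>"
    using arcs one unfolding abc clean_graph2_adjacent_iff by auto
  \<comment> \<open>Both are inverses of \<open>v\<close>, so the path would return to its
    start.\<close>
  then have "u = w"
    using units inv_unique m_comm by (metis Units_closed)
  then show False
    using \<open>a \<noteq> c\<close> one unfolding abc by simp
qed

end

theorem theorem4p1:
  fixes R :: "('r, 'm) ring_scheme"
  assumes "cring R"
  shows "(sdim (clean_graph R) < \<infinity> \<longleftrightarrow> finite (verts (clean_graph R))) \<and>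
         (sdim (clean_graph2 R) < \<infinity> \<longleftrightarrow> finite (verts (clean_graph2 R)))"
proof
  interpret cring R by fact
  show "sdim (clean_graph R) < \<infinity> \<longleftrightarrow> finite (verts (clean_graph R))"
    using sdim_finite_iff_finite_verts within_distance_clean_graph path_between_verts by metis
  show "sdim (clean_graph2 R) < \<infinity> \<longleftrightarrow> finite (verts (clean_graph2 R))"
  proof (cases "idempotents R \<subseteq> {\<zero>\<^bsub>R\<^esub>, \<one>\<^bsub>R\<^esub>}")
    case True
    \<comment> \<open>Each given path is its own witness for the bound 1.\<close>
    then show ?thesis
      using sdim_finite_iff_finite_verts path_length_clean_graph2_trivial_idempotents
      unfolding within_distance_def by metis
  next
    case False
    then obtain g where "g \<in> idempotents R" "g \<noteq> \<zero>\<^bsub>R\<^esub>" "g \<noteq> \<one>\<^bsub>R\<^esub>"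
      by blast
    then show ?thesis
      using sdim_finite_iff_finite_verts within_distance_clean_graph2 path_between_verts by metis
  qed
qed

end
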